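(* For each $d\in\mathbb{N}$ (with $d\ge1$) there exists a compact set $E\subset\mathbb{R}^d$ with $\mathcal{H}^d(E)=0$, $\underline{\dim}_M(E)=d$, and $\underline{\dim}_S(E)=d-1$.
   Context: $\mathcal{H}^\lambda$ denotes the $\lambda$-dimensional Hausdorff measure. Balls $B(x,r)$ are closed. For compact $E\subset\mathbb{R}^d$ and $\lambda\ge0$, $\mathcal{M}^\lambda_r(E)=\inf\{nr^\lambda: E\subset\bigcup_{k=1}^nB(x_k,r),\ x_k\in E\}$, and the lower Minkowski dimension is $\underline{\dim}_M(E)=\inf\{\lambda\ge0:\liminf_{r\downarrow0}\mathcal{M}^\lambda_r(E)=0\}$. $E_r=\{x\in\mathbb{R}^d:\operatorname{dist}(x,E)<r\}$ and $\partial E_r=\{x\in\mathbb{R}^d:\operatorname{dist}(x,E)=r\}$. The lower spherical dimension of compact $E$ is $$\underline{\dim}_S(E)=\inf\Big\{\lambda\ge0:\liminf_{r\downarrow0}\frac{\mathcal{H}^{d-1}(\partial E_r)}{r^{d-1-\lambda}}=0\Big\}.$$ *)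

theory Defs
  imports "HOL-Analysis.Analysis"
begin

text \<open>
  The summand \<open>(diam U)\<^sup>s\<close> in the definition of the Hausdorff measure. The exponent \<open>0\<close> is
  treated separately because \<open>0 powr 0 = 0\<close>, whereas a one-point set has to contribute \<open>1\<close>
  (so that the \<open>0\<close>-dimensional Hausdorff measure is the counting measure).
\<close>
definition hausdorff_gauge :: "real \<Rightarrow> 'a::metric_space set \<Rightarrow> ennreal" where
  "hausdorff_gauge s U =
     (if U = {} then 0 else if s = 0 then 1 else ennreal (diameter U powr s))"

text \<open>Boundedness is required explicitly because \<^const>\<open>diameter\<close> is meaningful only for bounded sets.\<close>
definition hausdorff_premeasure :: "real \<Rightarrow> real \<Rightarrow> 'a::metric_space set \<Rightarrow> ennreal" where
  "hausdorff_premeasure s \<delta> E =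
     (INF U \<in> {U :: nat \<Rightarrow> 'a set.
                 E \<subseteq> (\<Union>i. U i) \<and> (\<forall>i. bounded (U i) \<and> diameter (U i) \<le> \<delta>)}.
        \<Sum>i. hausdorff_gauge s (U i))"

text \<open>
  The Hausdorff (outer) measure, without a normalising constant. A positive constant factor
  affects neither the vanishing of the measure nor the spherical dimension below.
\<close>
definition hausdorff_measure :: "real \<Rightarrow> 'a::metric_space set \<Rightarrow> ennreal" where
  "hausdorff_measure s E = (SUP \<delta> \<in> {0<..}. hausdorff_premeasure s \<delta> E)"

definition minkowski_content :: "real \<Rightarrow> real \<Rightarrow> 'a::metric_space set \<Rightarrow> ennreal" where
  "minkowski_content s r E =
     (INF (n, x) \<in> {(n :: nat, x :: nat \<Rightarrow> 'a).
                      (\<forall>k\<in>{1..n}. x k \<in> E) \<and> E \<subseteq> (\<Union>k\<in>{1..n}. cball (x k) r)}.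
        ennreal (real n * r powr s))"

definition lower_minkowski_dim :: "'a::metric_space set \<Rightarrow> ereal" where
  "lower_minkowski_dim E =
     Inf {ereal s | s. 0 \<le> s \<and> Liminf (at_right 0) (\<lambda>r. minkowski_content s r E) = 0}"

text \<open>
  The boundary \<open>\<partial>E\<^sub>r\<close> of the parallel set, used for \<open>r > 0\<close> only. For such \<open>r\<close> it is empty if
  \<open>E\<close> is empty, as \<^const>\<open>infdist\<close> is then constantly \<open>0\<close>.
\<close>
definition parallel_boundary :: "'a::metric_space set \<Rightarrow> real \<Rightarrow> 'a set" where
  "parallel_boundary E r = {x. infdist x E = r}"

definition lower_spherical_dim :: "'a::euclidean_space set \<Rightarrow> ereal" where
  "lower_spherical_dim E =
     Inf {ereal s | s. 0 \<le> s \<and>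
       Liminf (at_right 0)
         (\<lambda>r. hausdorff_measure (real DIM('a) - 1) (parallel_boundary E r)
               / ennreal (r powr (real DIM('a) - 1 - s))) = 0}"

end

theory Submission
  imports Defs
begin

text \<open>
  The set is the union over \<open>k\<close> of the grids of mesh \<open>2\<^sup>-\<^sup>k / m\<^sub>k\<close> in the nested cubes
  \<open>[-2\<^sup>-\<^sup>k, 2\<^sup>-\<^sup>k]\<^sup>d\<close>, with \<open>m\<^sub>k = 2 ^ k!\<close>. It is countable, hence null. Write \<open>\<epsilon>\<^sub>k\<close> for \<open>d\<close> times the
  mesh. For \<open>r\<close> between \<open>\<epsilon>\<^sub>k\<^sub>+\<^sub>1\<close> and \<open>\<epsilon>\<^sub>k\<close> the set is \<open>r\<close>-dense in a cube whose side is larger than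
  any given power of \<open>r\<close> for large \<open>k\<close>; comparing volumes bounds the covering numbers from below by
  almost \<open>r\<^sup>-\<^sup>d\<close>, and projecting along an axis bounds the area of the boundary from below by almost a
  constant. At \<open>r = 2 \<epsilon>\<^sub>k\<close> the parallel set swallows the \<open>k\<close>-th cube, so its boundary is contained in
  the spheres around the outermost layers of the \<open>k\<close>-th grid, of total area bounded independently of
  \<open>k\<close>, and around the coarser grids, whose number of points is a negligible power of \<open>1 / r\<close> because
  \<open>m\<^sub>k\<^sub>+\<^sub>1\<close> dominates every fixed power of \<open>m\<^sub>k\<close>.
\<close>

section \<open>Upper bounds for the Hausdorff measure\<close>

lemma hausdorff_gauge_le:
  assumes "bounded U" "diameter U \<le> h" "0 < h" "0 \<le> s"
  shows "hausdorff_gauge s U \<le> ennreal (h powr s)"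
  using assms diameter_ge_0[OF assms(1)]
  by (auto simp: hausdorff_gauge_def intro!: ennreal_leI powr_mono2)

lemma hausdorff_premeasure_le_card:
  fixes E :: "'a::metric_space set"
  assumes fin: "finite \<U>" and cov: "E \<subseteq> \<Union>\<U>"
    and small: "\<And>U. U \<in> \<U> \<Longrightarrow> bounded U \<and> diameter U \<le> h"
    and h: "0 < h" "h \<le> \<delta>" and s: "0 \<le> s"
  shows "hausdorff_premeasure s \<delta> E \<le> ennreal (real (card \<U>) * h powr s)"
proof -
  obtain f where f: "bij_betw f {0..<card \<U>} \<U>"
    using ex_bij_betw_nat_finite[OF fin] by blast
  \<comment> \<open>Padding with empty sets costs nothing: their gauge is 0 for every exponent,
    including \<open>s = 0\<close>.\<close>
  define V where "V i = (if i < card \<U> then f i else {})" for i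
  have Vin: "V i \<in> \<U>" if "i < card \<U>" for i
    using f that by (auto simp: V_def bij_betw_def)
  have "E \<subseteq> (\<Union>i. V i)"
  proof
    fix x assume "x \<in> E"
    then obtain U where U: "U \<in> \<U>" "x \<in> U" using cov by auto
    then have "U \<in> f ` {0..<card \<U>}" using f by (simp add: bij_betw_def)
    then obtain i where "i < card \<U>" "f i = U" by auto
    then have "V i = U" by (simp add: V_def)
    then show "x \<in> (\<Union>i. V i)" using U by blast
  qed
  moreover have "bounded (V i) \<and> diameter (V i) \<le> \<delta>" for i
  proof (cases "i < card \<U>")
    case True
    then show ?thesis using small[OF Vin[of i]] h by auto
  next
    case False
    then show ?thesis using h by (simp add: V_def diameter_def)
  qed
  ultimately have "hausdorff_premeasure s \<delta> E \<le> (\<Sum>i. hausdorff_gauge s (V i))"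
    unfolding hausdorff_premeasure_def by (intro INF_lower) auto
  also have "\<dots> = (\<Sum>i<card \<U>. hausdorff_gauge s (V i))"
    by (intro suminf_finite) (auto simp: V_def hausdorff_gauge_def)
  also have "\<dots> \<le> (\<Sum>i<card \<U>. ennreal (h powr s))"
    using Vin small h s by (intro sum_mono hausdorff_gauge_le) auto
  also have "\<dots> = ennreal (real (card \<U>) * h powr s)"
    by (simp add: ennreal_mult ennreal_of_nat_eq_real_of_nat)
  finally show ?thesis .
qed

lemma hausdorff_measure_countable:
  fixes E :: "'a::metric_space set"
  assumes "countable E" "0 < s"
  shows "hausdorff_measure s E = 0"
proof -
  have "hausdorff_premeasure s \<delta> E \<le> 0" if "0 < \<delta>" for \<delta>
  proof (cases "E = {}")
    case True
    have "hausdorff_premeasure s \<delta> E \<le> (\<Sum>i::nat. hausdorff_gauge s ({}::'a set))"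
      unfolding hausdorff_premeasure_def using True that
      by (intro INF_lower) (auto simp: diameter_def)
    then show ?thesis by (simp add: hausdorff_gauge_def)
  next
    case False
    \<comment> \<open>The cover consists of singletons, whose gauge is \<open>0 powr s = 0\<close>
      because \<open>s\<close> is positive.\<close>
    have "hausdorff_premeasure s \<delta> E \<le> (\<Sum>i. hausdorff_gauge s {from_nat_into E i})"
      unfolding hausdorff_premeasure_def
      using that assms(1) False
      by (intro INF_lower) (auto dest: from_nat_into_surj)
    then show ?thesis using assms(2) by (simp add: hausdorff_gauge_def)
  qed
  then show ?thesis by (auto simp: hausdorff_measure_def)
qed

text \<open>Used with one distinguished coordinate \<open>i\<close>: to count the patches of a face
  of a cube, and the grid points near such a face.\<close>

lemma card_fun_pointed:
  fixes i :: "'n::finite"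
  assumes "finite A" "finite B"
  shows "finite {z. \<forall>j. z j \<in> (if j = i then A else B)}"
    and "card {z. \<forall>j. z j \<in> (if j = i then A else B)} = card A * card B ^ (CARD('n) - 1)"
proof -
  have eq: "{z. \<forall>j. z j \<in> (if j = i then A else B)} = PiE UNIV (\<lambda>j. if j = i then A else B)"
    by (auto simp: PiE_def Pi_def split: if_splits)
  show "finite {z. \<forall>j. z j \<in> (if j = i then A else B)}"
    unfolding eq using assms by (intro finite_PiE) auto
  have "(\<Prod>j\<in>UNIV. card (if j = i then A else B))
      = card A * (\<Prod>j\<in>UNIV - {i}. card (if j = i then A else B))"
    by (subst prod.remove[of _ i]) auto
  also have "(\<Prod>j\<in>UNIV - {i}. card (if j = i then A else B)) = (\<Prod>j\<in>UNIV - {i}. card B)"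
    by (intro prod.cong) auto
  finally show "card {z. \<forall>j. z j \<in> (if j = i then A else B)} = card A * card B ^ (CARD('n) - 1)"
    unfolding eq by (subst card_PiE) (auto simp: card_Diff_singleton)
qed

lemma norm_le_card_mult:
  fixes x :: "real ^ 'n"
  assumes "\<And>i. \<bar>x $ i\<bar> \<le> h"
  shows "norm x \<le> real CARD('n) * h"
proof -
  have "norm x \<le> (\<Sum>i\<in>UNIV. \<bar>x $ i\<bar>)" by (rule norm_le_l1_cart)
  also have "\<dots> \<le> (\<Sum>i\<in>(UNIV::'n set). h)" using assms by (intro sum_mono) auto
  finally show ?thesis by simp
qed

text \<open>By the triangle inequality through the centre, no point of the ball is closer to
  \<open>p + t *\<^sub>R v\<close> than \<open>t * r - r\<close>, and \<open>p + v\<close> attains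
  this distance.\<close>

lemma closest_point_cball_radial:
  fixes p v :: "'a::euclidean_space"
  assumes "norm v = r" "1 \<le> t"
  shows "closest_point (cball p r) (p + t *\<^sub>R v) = p + v"
proof (rule closest_point_unique[symmetric])
  show "p + v \<in> cball p r" using assms by (simp add: dist_norm)
  show "\<forall>z\<in>cball p r. dist (p + t *\<^sub>R v) (p + v) \<le> dist (p + t *\<^sub>R v) z"
  proof
    fix z assume "z \<in> cball p r"
    then have "dist p z \<le> r" by simp
    have "dist (p + t *\<^sub>R v) (p + v) = norm ((t - 1) *\<^sub>R v)"
      by (simp add: dist_norm algebra_simps)
    then have "dist (p + t *\<^sub>R v) (p + v) = t * r - r"
      using assms by (simp add: left_diff_distrib)
    also have "t * r = dist (p + t *\<^sub>R v) p" using assms by (simp add: dist_norm)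
    finally show "dist (p + t *\<^sub>R v) (p + v) \<le> dist (p + t *\<^sub>R v) z"
      using \<open>dist p z \<le> r\<close> dist_triangle[of "p + t *\<^sub>R v" p z]
      by (simp add: dist_commute)
  qed
qed auto

lemma obtain_subinterval:
  fixes u :: real
  assumes "0 \<le> u" "u \<le> real n" "0 < n"
  obtains k where "k < n" "real k \<le> u" "u \<le> real k + 1"
proof
  \<comment> \<open>The minimum takes care of the right endpoint \<open>u = n\<close>, whose floor
    would be out of range.\<close>
  let ?k = "min (nat \<lfloor>u\<rfloor>) (n - 1)"
  show "?k < n" using assms by auto
  show "real ?k \<le> u" using assms by linarith
  show "u \<le> real ?k + 1" using assms by linarith
qed

text \<open>The sphere is the image of the surface of the circumscribed cube under the metric projection
  onto the ball, which does not increase distances.\<close>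
lemma sphere_cover:
  fixes p :: "real ^ 'n"
  assumes r: "0 < r" and n: "0 < n"
  shows "\<exists>\<U>. finite \<U> \<and> card \<U> \<le> 2 * CARD('n) * n ^ (CARD('n) - 1) \<and> sphere p r \<subseteq> \<Union>\<U> \<and>
    (\<forall>U\<in>\<U>. bounded U \<and> diameter U \<le> real CARD('n) * (2 * r / real n))"
proof -
  define h where "h = 2 * r / real n"
  have h: "0 < h" using r n by (simp add: h_def)
  \<comment> \<open>Coordinate \<open>i\<close> is constant on the face, so its index is frozen at
    the dummy value 0; this leaves exponent \<open>CARD('n) - 1\<close> in the count.\<close>
  define Z where "Z i = {z::'n \<Rightarrow> nat. \<forall>j. z j \<in> (if j = i then {0} else {..<n})}" for i
  have Z: "finite (Z i)" "card (Z i) = n ^ (CARD('n) - 1)" for i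
    unfolding Z_def using card_fun_pointed[of "{0::nat}" "{..<n}" i] by simp_all
  define F where "F = (\<lambda>(i::'n, \<sigma>::real, z). {x. x $ i = p $ i + \<sigma> * r \<and>
     (\<forall>j. j \<noteq> i \<longrightarrow> p $ j - r + h * real (z j) \<le> x $ j \<and> x $ j \<le> p $ j - r + h * (real (z j) + 1))})"
  define I where "I = (SIGMA i:UNIV. {-1,1::real} \<times> Z i)"
  define \<U> where "\<U> = (\<lambda>a. closest_point (cball p r) ` F a) ` I"
  have finI: "finite I" unfolding I_def using Z by auto
  have cardI: "card I = 2 * CARD('n) * n ^ (CARD('n) - 1)"
    unfolding I_def using Z by (subst card_SigmaI) (auto simp: card_cartesian_product)
  have "finite \<U>" using finI by (simp add: \<U>_def)
  moreover have "card \<U> \<le> 2 * CARD('n) * n ^ (CARD('n) - 1)"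
    unfolding \<U>_def cardI[symmetric] by (rule card_image_le[OF finI])
  moreover have "bounded U \<and> diameter U \<le> real CARD('n) * h" if U: "U \<in> \<U>" for U
  proof
    obtain i \<sigma> z where a: "U = closest_point (cball p r) ` F (i,\<sigma>,z)"
      using U by (auto simp: \<U>_def I_def)
    have "closest_point (cball p r) x \<in> cball p r" for x
      using r by (intro closest_point_in_set) auto
    then show "bounded U" unfolding a by (intro bounded_subset[OF bounded_cball]) blast
    show "diameter U \<le> real CARD('n) * h"
    proof (rule diameter_le)
      show "U \<noteq> {} \<or> 0 \<le> real CARD('n) * h" using h by simp
      fix u v assume "u \<in> U" "v \<in> U"
      then obtain x y where x: "x \<in> F (i,\<sigma>,z)" "u = closest_point (cball p r) x"
        and y: "y \<in> F (i,\<sigma>,z)" "v = closest_point (cball p r) y"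
        unfolding a by blast
      have "dist u v \<le> dist x y"
        unfolding x(2) y(2) using r by (intro closest_point_lipschitz) auto
      also have "\<dots> \<le> real CARD('n) * h"
        unfolding dist_norm
      proof (rule norm_le_card_mult)
        fix j show "\<bar>(x - y) $ j\<bar> \<le> h"
        proof (cases "j = i")
          case False
          then have "p $ j - r + h * real (z j) \<le> x $ j" "x $ j \<le> p $ j - r + h * real (z j) + h"
            "p $ j - r + h * real (z j) \<le> y $ j" "y $ j \<le> p $ j - r + h * real (z j) + h"
            using x(1) y(1) by (auto simp: F_def distrib_left)
          then show ?thesis unfolding vector_minus_component abs_le_iff by linarith
        qed (use x(1) y(1) h in \<open>simp add: F_def\<close>)
      qed
      finally show "norm (u - v) \<le> real CARD('n) * h" by (simp add: dist_norm)
    qed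
  qed
  moreover have "sphere p r \<subseteq> \<Union>\<U>"
  proof
    fix y assume "y \<in> sphere p r"
    define v where "v = y - p"
    have v: "norm v = r" "y = p + v" using \<open>y \<in> sphere p r\<close>
      by (auto simp: v_def dist_norm norm_minus_commute)
    \<comment> \<open>\<open>M\<close> is the maximum norm of \<open>v\<close>; a coordinate
      attaining it selects the face of the cube that the ray through \<open>y\<close> hits.\<close>
    define M where "M = Max (range (\<lambda>j. \<bar>v $ j\<bar>))"
    have "M \<in> range (\<lambda>j. \<bar>v $ j\<bar>)" unfolding M_def by (intro Max_in) auto
    then obtain i where i: "M = \<bar>v $ i\<bar>" by auto
    have M: "\<bar>v $ j\<bar> \<le> M" for j unfolding M_def by (intro Max_ge) auto
    have "M > 0"
    proof (rule ccontr)
      assume "\<not> M > 0"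
      then have "\<bar>v $ j\<bar> \<le> 0" for j using M[of j] by linarith
      then have "v = 0" by (simp add: vec_eq_iff)
      then show False using v r by simp
    qed
    have "M \<le> r" using i component_le_norm_cart[of v i] v by simp
    \<comment> \<open>Stretching by \<open>r / M\<close> moves \<open>y\<close> radially out to the
      surface of the cube. The factor is at least 1, so the projection sends \<open>x\<close> back
      to \<open>y\<close>.\<close>
    define x where "x = p + (r / M) *\<^sub>R v"
    have cp: "closest_point (cball p r) x = y"
      unfolding x_def v(2) using \<open>M > 0\<close> \<open>M \<le> r\<close> v(1) by (intro closest_point_cball_radial) auto
    have xj: "\<bar>x $ j - p $ j\<bar> \<le> r" for j
      using M[of j] \<open>M > 0\<close> r by (simp add: x_def abs_mult field_simps)
    have xi: "x $ i = p $ i + sgn (v $ i) * r"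
      using i \<open>M > 0\<close> by (auto simp: x_def sgn_if abs_if split: if_splits)
    have "\<exists>k<n. p $ j - r + h * real k \<le> x $ j \<and> x $ j \<le> p $ j - r + h * (real k + 1)" for j
    proof -
      have "0 \<le> (x $ j - p $ j + r) / h" using xj[of j] h by simp
      moreover have "(x $ j - p $ j + r) / h \<le> real n"
      proof -
        have "real n * h = 2 * r" using n by (simp add: h_def)
        then have "x $ j - p $ j + r \<le> real n * h" using xj[of j] by linarith
        then show ?thesis using h by (simp add: divide_le_eq)
      qed
      ultimately obtain k where "k < n" "real k \<le> (x $ j - p $ j + r) / h"
        "(x $ j - p $ j + r) / h \<le> real k + 1"
        using n by (rule obtain_subinterval)
      then show ?thesis using h by (intro exI[of _ k]) (auto simp: field_simps)
    qed
    then obtain k where k: "\<And>j. k j < n \<and> p $ j - r + h * real (k j) \<le> x $ j \<and>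
        x $ j \<le> p $ j - r + h * (real (k j) + 1)" by metis
    define z where "z j = (if j = i then 0 else k j)" for j
    have "z \<in> Z i" using k by (auto simp: Z_def z_def)
    moreover have "sgn (v $ i) \<in> {-1, 1}" using i \<open>M > 0\<close> by (auto simp: sgn_if)
    ultimately have "(i, sgn (v $ i), z) \<in> I" by (auto simp: I_def)
    moreover have "x \<in> F (i, sgn (v $ i), z)" using xi k by (auto simp: F_def z_def)
    ultimately show "y \<in> \<Union>\<U>" using cp unfolding \<U>_def by blast
  qed
  ultimately show ?thesis unfolding h_def by blast
qed

text \<open>Each sphere needs about \<open>n ^ (d - 1)\<close> pieces of diameter about
  \<open>r / n\<close>. With exponent \<open>d - 1\<close> the number \<open>n\<close> cancels, so
  the bound does not depend on the scale \<open>\<delta>\<close>.\<close>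

lemma hausdorff_measure_subset_spheres:
  fixes S P :: "(real ^ 'n) set"
  assumes fin: "finite P" and r: "0 < r" and sub: "S \<subseteq> (\<Union>p\<in>P. sphere p r)"
  shows "hausdorff_measure (real CARD('n) - 1) S
     \<le> ennreal (real (card P) * (2 * real CARD('n) * (2 * real CARD('n) * r) ^ (CARD('n) - 1)))"
proof -
  define d where "d = CARD('n)"
  have d: "0 < d" by (simp add: d_def)
  have "hausdorff_premeasure (real d - 1) \<delta> S
     \<le> ennreal (real (card P) * (2 * real d * (2 * real d * r) ^ (d - 1)))" if \<delta>: "0 < \<delta>" for \<delta>
  proof -
    \<comment> \<open>Fine enough that the pieces have diameter at most \<open>\<delta>\<close>;
      \<open>Suc\<close> keeps \<open>n\<close> positive.\<close>
    define n where "n = Suc (nat \<lceil>real d * (2 * r) / \<delta>\<rceil>)"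
    define h where "h = real d * (2 * r / real n)"
    have n: "0 < n" by (simp add: n_def)
    have h: "0 < h" using r n d by (simp add: h_def)
    have "real d * (2 * r) / \<delta> \<le> real n" unfolding n_def by linarith
    then have h\<delta>: "h \<le> \<delta>" using n \<delta> by (simp add: h_def field_simps)
    have "\<exists>\<U>. finite \<U> \<and> card \<U> \<le> 2 * d * n ^ (d - 1) \<and> sphere p r \<subseteq> \<Union>\<U> \<and>
      (\<forall>U\<in>\<U>. bounded U \<and> diameter U \<le> h)" for p :: "real ^ 'n"
      using sphere_cover[OF r n] unfolding d_def h_def by blast
    then obtain \<U> where \<U>: "\<And>p::real ^ 'n. finite (\<U> p)" "\<And>p. card (\<U> p) \<le> 2 * d * n ^ (d - 1)"
      "\<And>p. sphere p r \<subseteq> \<Union>(\<U> p)" "\<And>p U. U \<in> \<U> p \<Longrightarrow> bounded U \<and> diameter U \<le> h"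
      by metis
    have "card (\<Union>p\<in>P. \<U> p) \<le> (\<Sum>p\<in>P. card (\<U> p))" by (rule card_UN_le[OF fin])
    also have "\<dots> \<le> (\<Sum>p\<in>P. 2 * d * n ^ (d - 1))" using \<U>(2) by (intro sum_mono) auto
    finally have card: "card (\<Union>p\<in>P. \<U> p) \<le> card P * (2 * d * n ^ (d - 1))" by simp
    have "hausdorff_premeasure (real d - 1) \<delta> S
       \<le> ennreal (real (card (\<Union>p\<in>P. \<U> p)) * h powr (real d - 1))"
    proof (rule hausdorff_premeasure_le_card)
      show "finite (\<Union>p\<in>P. \<U> p)" using fin \<U>(1) by (intro finite_UN_I)
      show "S \<subseteq> \<Union>(\<Union>p\<in>P. \<U> p)"
      proof
        fix x assume "x \<in> S"
        then obtain p where "p \<in> P" "x \<in> sphere p r" using sub by auto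
        moreover from this obtain U where "U \<in> \<U> p" "x \<in> U" using \<U>(3)[of p] by auto
        ultimately show "x \<in> \<Union>(\<Union>p\<in>P. \<U> p)" by auto
      qed
      show "bounded U \<and> diameter U \<le> h" if "U \<in> (\<Union>p\<in>P. \<U> p)" for U
        using that \<U>(4) by blast
    qed (use h h\<delta> d in auto)
    also have "\<dots> \<le> ennreal (real (card P * (2 * d * n ^ (d - 1))) * h powr (real d - 1))"
      using card by (intro ennreal_leI mult_right_mono) (simp_all only: of_nat_le_iff powr_ge_zero)
    also have "h powr (real d - 1) = h ^ (d - 1)"
      using h d powr_realpow[of h "d - 1"] by (simp add: of_nat_diff)
    also have "real (card P * (2 * d * n ^ (d - 1))) * h ^ (d - 1)
        = real (card P) * (2 * real d * (2 * real d * r) ^ (d - 1))"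
      using n by (simp add: h_def power_divide power_mult_distrib)
    finally show ?thesis .
  qed
  then show ?thesis unfolding hausdorff_measure_def d_def by (intro SUP_least) auto
qed

section \<open>Lower bounds from Lebesgue measure\<close>

lemma emeasure_lborel_cbox_cart:
  fixes a b :: "real ^ 'n"
  assumes "\<And>i. a $ i \<le> b $ i"
  shows "emeasure lborel (cbox a b) = ennreal (\<Prod>i\<in>UNIV. b $ i - a $ i)"
proof -
  have "emeasure lborel (cbox a b) = ennreal (measure lborel (cbox a b))"
    using emeasure_lborel_cbox_finite[of a b] by (intro emeasure_eq_ennreal_measure) auto
  also have "measure lborel (cbox a b) = (\<Prod>i\<in>UNIV. b $ i - a $ i)"
    using assms by (intro content_cbox_cart) (auto simp: interval_ne_empty_cart)
  finally show ?thesis .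
qed

definition cube :: "real \<Rightarrow> (real ^ 'n) set" where
  "cube a = {x. \<forall>i. \<bar>x $ i\<bar> \<le> a}"

lemma cube_eq_cbox: "cube a = cbox (\<chi> i. - a) (\<chi> i. a)"
  by (auto simp: cube_def mem_box_cart abs_le_iff minus_le_iff)

lemma emeasure_cube:
  assumes "0 \<le> a"
  shows "emeasure lborel (cube a :: (real ^ 'n) set) = ennreal ((2 * a) ^ CARD('n))"
  unfolding cube_eq_cbox using assms by (subst emeasure_lborel_cbox_cart) auto

text \<open>Volume comparison: if \<open>n\<close> balls of radius \<open>r\<close> cover
  \<open>E\<close>, then \<open>n\<close> cubes of side \<open>4 * r\<close> cover
  \<open>cube a\<close>, so \<open>(2 * a) ^ d \<le> n * (4 * r) ^ d\<close>.\<close>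

lemma minkowski_content_ge:
  fixes E :: "(real ^ 'n) set"
  assumes r: "0 < r" and a: "0 \<le> a" and dense: "\<And>y. y \<in> cube a \<Longrightarrow> \<exists>p\<in>E. dist p y \<le> r"
  shows "ennreal ((a / 2) ^ CARD('n) * r powr (s - real CARD('n))) \<le> minkowski_content s r E"
  unfolding minkowski_content_def
proof (rule INF_greatest, clarify)
  fix n :: nat and x :: "nat \<Rightarrow> real ^ 'n"
  assume cov: "E \<subseteq> (\<Union>k\<in>{1..n}. cball (x k) r)"
  define d where "d = CARD('n)"
  \<comment> \<open>Half-side \<open>2 * r\<close>: one \<open>r\<close> from a point of the cube to
    \<open>E\<close>, another from there to a centre.\<close>
  define C where "C k = cbox (x k - (\<chi> i. 2 * r)) (x k + (\<chi> i. 2 * r))" for k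
  have "cube a \<subseteq> (\<Union>k\<in>{1..n}. C k)"
  proof
    fix y :: "real ^ 'n" assume "y \<in> cube a"
    then obtain p where p: "p \<in> E" "dist p y \<le> r" using dense by blast
    then obtain k where k: "k \<in> {1..n}" "dist (x k) p \<le> r" using cov by auto
    have "norm (y - x k) \<le> 2 * r"
      using p(2) k(2) dist_triangle[of "x k" y p] by (simp add: dist_norm norm_minus_commute)
    then have "\<bar>(y - x k) $ i\<bar> \<le> 2 * r" for i
      using component_le_norm_cart[of "y - x k" i] by linarith
    then have "y \<in> C k"
      by (auto simp: C_def mem_box_cart abs_le_iff algebra_simps)
    then show "y \<in> (\<Union>k\<in>{1..n}. C k)" using k by blast
  qed
  then have "emeasure lborel (cube a :: (real ^ 'n) set) \<le> emeasure lborel (\<Union>k\<in>{1..n}. C k)"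
    by (intro emeasure_mono) (auto simp: C_def)
  also have "\<dots> \<le> (\<Sum>k\<in>{1..n}. emeasure lborel (C k))"
    by (intro emeasure_subadditive_finite) (auto simp: C_def)
  also have "\<dots> = (\<Sum>k\<in>{1..n}. ennreal ((4 * r) ^ d))"
    using r by (intro sum.cong refl) (simp add: C_def emeasure_lborel_cbox_cart d_def)
  also have "\<dots> = ennreal (real n * (4 * r) ^ d)"
    using r by (simp add: ennreal_mult ennreal_of_nat_eq_real_of_nat)
  finally have "(2 * a) ^ d \<le> real n * (4 * r) ^ d"
    using r a by (simp add: emeasure_cube d_def)
  then have "(2 * a) ^ d / 4 ^ d \<le> real n * r ^ d"
    by (simp add: power_mult_distrib field_simps)
  also have "(2 * a) ^ d / 4 ^ d = (a / 2) ^ d"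
    unfolding power_divide[symmetric] by simp
  finally have "(a / 2) ^ d * r powr (s - real d) \<le> real n * r ^ d * r powr (s - real d)"
    by (intro mult_right_mono) auto
  also have "\<dots> = real n * r powr s"
    using r by (simp add: powr_diff powr_realpow)
  finally show "ennreal ((a / 2) ^ CARD('n) * r powr (s - real CARD('n))) \<le> ennreal (real n * r powr s)"
    unfolding d_def by (rule ennreal_leI)
qed

text \<open>Intermediate value theorem along the ray: the distance to \<open>E\<close> starts at
  most at \<open>r\<close> and is at least \<open>r\<close> far out, since \<open>E\<close> is
  bounded.\<close>

lemma ex_parallel_boundary_on_line:
  fixes E :: "'a::euclidean_space set"
  assumes E: "compact E" "E \<noteq> {}" and y: "infdist y E \<le> r" and v: "norm v = 1"
  shows "\<exists>t. y + t *\<^sub>R v \<in> parallel_boundary E r"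
proof -
  obtain M where M: "\<And>p. p \<in> E \<Longrightarrow> norm p \<le> M"
    using compact_imp_bounded[OF E(1)] bounded_iff by blast
  \<comment> \<open>After travelling \<open>T\<close>, every point of \<open>E\<close> is at
    distance at least \<open>T - norm y - \<bar>M\<bar> = \<bar>r\<bar>\<close>.\<close>
  define T where "T = norm y + \<bar>M\<bar> + \<bar>r\<bar>"
  obtain p where p: "p \<in> E" "infdist (y + T *\<^sub>R v) E = dist (y + T *\<^sub>R v) p"
    using infdist_attains_inf[OF compact_imp_closed] E by metis
  have "T = norm ((y + T *\<^sub>R v - p) - (y - p))" using v by (simp add: T_def)
  also have "\<dots> \<le> norm (y + T *\<^sub>R v - p) + norm (y - p)" by (rule norm_triangle_ineq4)
  finally have "r \<le> infdist (y + T *\<^sub>R v) E"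
    using norm_triangle_ineq4[of y p] M[OF p(1)] unfolding p(2) unfolding T_def dist_norm by linarith
  moreover have "continuous_on {0..T} (\<lambda>t. infdist (y + t *\<^sub>R v) E)"
    by (intro continuous_intros)
  moreover have "0 \<le> T" by (simp add: T_def)
  ultimately obtain t where "infdist (y + t *\<^sub>R v) E = r"
    using IVT'[of "\<lambda>t. infdist (y + t *\<^sub>R v) E" 0 r T] y by auto
  then show ?thesis unfolding parallel_boundary_def by blast
qed

text \<open>The boundary meets every line in direction of the \<open>i\<close>-th axis through the cube. Replacing each
  covering set by a box that contains it, extended through the cube along that axis, turns a cover of
  the boundary into a cover of the cube.\<close>
lemma hausdorff_measure_parallel_boundary_ge:
  fixes E :: "(real ^ 'n) set"
  assumes E: "compact E" "E \<noteq> {}" and a: "0 < a" and card: "2 \<le> CARD('n)"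
    and near: "\<And>y. y \<in> cube a \<Longrightarrow> infdist y E \<le> r"
  shows "ennreal (a ^ (CARD('n) - 1)) \<le> hausdorff_measure (real CARD('n) - 1) (parallel_boundary E r)"
proof -
  define d where "d = CARD('n)"
  have d: "2 \<le> d" using card by (simp add: d_def)
  obtain i :: 'n where True by blast
  have "ennreal (a ^ (d - 1)) \<le> (\<Sum>j. hausdorff_gauge (real d - 1) (U j))"
    if cov: "parallel_boundary E r \<subseteq> (\<Union>j. U j)" and bd: "\<And>j. bounded (U j)"
    for U :: "nat \<Rightarrow> (real ^ 'n) set"
  proof -
    define u where "u j = (SOME x. x \<in> U j)" for j
    \<comment> \<open>Half-widths of the box: \<open>a\<close> spans the cube in direction
      \<open>i\<close>; in the other directions the diameter suffices around the chosen point
      \<open>u j\<close> of \<open>U j\<close>.\<close>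
    define w where "w j = (\<chi> l. if l = i then a else diameter (U j))" for j
    define c where "c j = (\<chi> l. if l = i then 0 else u j $ l)" for j
    define B where "B j = (if U j = {} then {} else cbox (c j - w j) (c j + w j))" for j
    have "cube a \<subseteq> (\<Union>j. B j)"
    proof
      fix y :: "real ^ 'n" assume y: "y \<in> cube a"
      then obtain t where "y + t *\<^sub>R axis i 1 \<in> parallel_boundary E r"
        using ex_parallel_boundary_on_line[OF E near] norm_axis_1 by blast
      then obtain j where j: "y + t *\<^sub>R axis i 1 \<in> U j" using cov by blast
      have u: "u j \<in> U j" unfolding u_def using j by (rule someI)
      have "\<bar>y $ l - u j $ l\<bar> \<le> diameter (U j)" if "l \<noteq> i" for l
      proof -
        have "\<bar>(y + t *\<^sub>R axis i 1 - u j) $ l\<bar> \<le> dist (y + t *\<^sub>R axis i 1) (u j)"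
          unfolding dist_norm by (rule component_le_norm_cart)
        also have "\<dots> \<le> diameter (U j)" using bd j u by (intro diameter_bounded_bound)
        finally show ?thesis using that by (simp add: axis_def)
      qed
      then have "y \<in> cbox (c j - w j) (c j + w j)"
        using y by (auto simp: mem_box_cart c_def w_def cube_def abs_le_iff algebra_simps; smt)
      then show "y \<in> (\<Union>j. B j)" using j by (auto simp: B_def)
    qed
    then have "emeasure lborel (cube a :: (real ^ 'n) set) \<le> emeasure lborel (\<Union>j. B j)"
      by (intro emeasure_mono) (auto simp: B_def)
    also have "\<dots> \<le> (\<Sum>j. emeasure lborel (B j))"
      by (intro emeasure_subadditive_countably) (auto simp: B_def)
    also have "\<dots> \<le> (\<Sum>j. ennreal (a * 2 ^ d) * hausdorff_gauge (real d - 1) (U j))"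
    proof (intro suminf_le)
      fix j
      show "emeasure lborel (B j) \<le> ennreal (a * 2 ^ d) * hausdorff_gauge (real d - 1) (U j)"
      proof (cases "U j = {}")
        case False
        have diam: "0 \<le> diameter (U j)" by (rule diameter_ge_0[OF bd])
        have "emeasure lborel (B j) = ennreal (\<Prod>l\<in>UNIV. 2 * w j $ l)"
          using False a diam
          by (simp add: B_def, subst emeasure_lborel_cbox_cart) (auto simp: w_def intro!: arg_cong[of _ _ ennreal])
        also have "(\<Prod>l\<in>UNIV. 2 * w j $ l) = 2 * w j $ i * (\<Prod>l\<in>UNIV - {i}. 2 * w j $ l)"
          by (rule prod.remove) auto
        also have "(\<Prod>l\<in>UNIV - {i}. 2 * w j $ l) = (\<Prod>l\<in>UNIV - {i}. 2 * diameter (U j))"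
          by (intro prod.cong) (auto simp: w_def)
        also have "\<dots> = (2 * diameter (U j)) ^ (d - 1)"
          by (simp add: card_Diff_singleton d_def)
        also have "2 * w j $ i * (2 * diameter (U j)) ^ (d - 1) = a * 2 ^ d * diameter (U j) ^ (d - 1)"
          using d by (cases d) (auto simp: w_def power_mult_distrib)
        \<comment> \<open>Here \<open>2 \<le> d\<close> makes the exponent positive: natural and
          real powers agree even at diameter 0, and the gauge is in its \<open>powr\<close>
          case.\<close>
        also have "diameter (U j) ^ (d - 1) = diameter (U j) powr (real d - 1)"
          using powr_realpow'[of "diameter (U j)" "d - 1"] diam d by (simp add: of_nat_diff)
        finally show ?thesis
          using a d False by (simp add: hausdorff_gauge_def ennreal_mult)
      qed (simp add: B_def)
    qed auto
    also have "\<dots> = ennreal (a * 2 ^ d) * (\<Sum>j. hausdorff_gauge (real d - 1) (U j))" by simp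
    \<comment> \<open>The volume of the cube is split so that the factor \<open>a * 2 ^ d\<close> of
      the box volumes cancels.\<close>
    also have "emeasure lborel (cube a :: (real ^ 'n) set) = ennreal (a * 2 ^ d) * ennreal (a ^ (d - 1))"
      using a d by (cases d) (auto simp: emeasure_cube d_def[symmetric] power_mult_distrib
          ennreal_mult[symmetric] ac_simps)
    finally show ?thesis
      using a by (simp add: ennreal_mult_le_mult_iff)
  qed
  then have "ennreal (a ^ (d - 1)) \<le> hausdorff_premeasure (real d - 1) 1 (parallel_boundary E r)"
    unfolding hausdorff_premeasure_def by (intro INF_greatest) auto
  also have "\<dots> \<le> hausdorff_measure (real d - 1) (parallel_boundary E r)"
    unfolding hausdorff_measure_def by (intro SUP_upper) auto
  finally show ?thesis by (simp add: d_def)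
qed

section \<open>Criteria for compactness, covering numbers and vanishing lower limits\<close>

lemma compact_if_accumulates_only_at:
  fixes E :: "'a::metric_space set"
  assumes "c \<in> E" and fin: "\<And>e. 0 < e \<Longrightarrow> finite (E - ball c e)"
  shows "compact E"
proof (rule compactI)
  fix \<C> :: "'a set set" assume \<C>: "\<forall>T\<in>\<C>. open T" "E \<subseteq> \<Union>\<C>"
  \<comment> \<open>The open set around \<open>c\<close> absorbs a whole ball, leaving finitely many
    points to cover.\<close>
  then obtain T where T: "T \<in> \<C>" "c \<in> T" using assms(1) by blast
  then obtain e where e: "0 < e" "ball c e \<subseteq> T" using \<C>(1) open_contains_ball by metis
  have "compact (E - ball c e)" using fin[OF e(1)] by (rule finite_imp_compact)
  then obtain \<D> where \<D>: "\<D> \<subseteq> \<C>" "finite \<D>" "E - ball c e \<subseteq> \<Union>\<D>"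
    using \<C> by (meson Diff_subset compactE order_trans)
  then show "\<exists>\<C>'\<subseteq>\<C>. finite \<C>' \<and> E \<subseteq> \<Union>\<C>'"
    using T e(2) by (intro exI[of _ "insert T \<D>"]) auto
qed

lemma minkowski_content_le_card:
  assumes "finite P" "P \<subseteq> E" "E \<subseteq> (\<Union>p\<in>P. cball p r)"
  shows "minkowski_content s r E \<le> ennreal (real (card P) * r powr s)"
proof -
  obtain x where x: "bij_betw x {1..card P} P"
    using ex_bij_betw_nat_finite_1[OF assms(1)] by blast
  then have "x ` {1..card P} = P" by (simp add: bij_betw_def)
  then have "\<forall>k\<in>{1..card P}. x k \<in> E" "E \<subseteq> (\<Union>p\<in>x ` {1..card P}. cball p r)"
    using assms(2,3) by (blast, simp only:)
  then have "(card P, x) \<in> {(n, x). (\<forall>k\<in>{1..n}. x k \<in> E) \<and> E \<subseteq> (\<Union>k\<in>{1..n}. cball (x k) r)}"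
    by blast
  then show ?thesis unfolding minkowski_content_def by (intro INF_lower2) auto
qed

text \<open>One sequence of radii suffices: a positive lower limit would keep \<open>f\<close> above
  a positive constant along \<open>\<rho>\<close> as well.\<close>

lemma Liminf_at_right_eq_0I:
  fixes f :: "real \<Rightarrow> ennreal"
  assumes \<rho>: "\<rho> \<longlonglongrightarrow> 0" "\<And>k. 0 < \<rho> k"
    and f: "\<forall>\<^sub>F k in sequentially. f (\<rho> k) \<le> ennreal (c k)" and c: "c \<longlonglongrightarrow> 0"
  shows "Liminf (at_right 0) f = 0"
proof (rule ccontr)
  assume "Liminf (at_right 0) f \<noteq> 0"
  then obtain y where y: "0 < y" "y < Liminf (at_right 0) f"
    using dense by (metis not_gr_zero)
  then have "\<forall>\<^sub>F x in at_right 0. y < f x" using le_Liminf_iff by blast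
  moreover have "filterlim \<rho> (at_right 0) sequentially"
    using \<rho> by (auto simp: filterlim_at less_imp_neq[symmetric])
  ultimately have "\<forall>\<^sub>F k in sequentially. y < f (\<rho> k)" by (rule eventually_compose_filterlim)
  moreover have "(\<lambda>k. ennreal (c k)) \<longlonglongrightarrow> 0" using tendsto_ennrealI[OF c] by simp
  then have "\<forall>\<^sub>F k in sequentially. ennreal (c k) < y" using y(1) by (rule order_tendstoD)
  ultimately have "\<forall>\<^sub>F k in sequentially. False" using f by eventually_elim auto
  then show False by simp
qed

section \<open>The union of grids\<close>

text \<open>The factorial gives \<open>gridnum (Suc k) = gridnum k ^ Suc k\<close>, growth faster
  than any fixed power of the previous value.\<close>

definition gridnum :: "nat \<Rightarrow> nat" where "gridnum k = 2 ^ fact k"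

definition halfside :: "nat \<Rightarrow> real" where "halfside k = (1 / 2) ^ k"

definition mesh :: "nat \<Rightarrow> real" where "mesh k = halfside k / real (gridnum k)"

definition grid_index :: "nat \<Rightarrow> int set" where
  "grid_index k = {- int (gridnum k)..int (gridnum k)}"

definition grid_point :: "nat \<Rightarrow> ('n \<Rightarrow> int) \<Rightarrow> real ^ 'n" where
  "grid_point k z = (\<chi> i. mesh k * of_int (z i))"

definition grid :: "nat \<Rightarrow> (real ^ 'n) set" where
  "grid k = grid_point k ` {z. \<forall>i. z i \<in> grid_index k}"

text \<open>\<open>w\<close> counts mesh steps inwards from the faces of the cube;
  \<open>w = 0\<close> gives the grid points on the faces themselves.\<close>

definition grid_surface :: "nat \<Rightarrow> int \<Rightarrow> (real ^ 'n) set" where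
  "grid_surface k w = grid_point k `
     {z. (\<forall>i. z i \<in> grid_index k) \<and> (\<exists>i. int (gridnum k) - w \<le> \<bar>z i\<bar>)}"

definition grids :: "(real ^ 'n) set" where "grids = (\<Union>k. grid k)"

section \<open>Sizes, density and compactness of the grids\<close>

lemma gridnum_pos [simp]: "0 < gridnum k" by (simp add: gridnum_def)
lemma halfside_pos [simp]: "0 < halfside k" by (simp add: halfside_def)
lemma halfside_le_1 [simp]: "halfside k \<le> 1" by (simp add: halfside_def power_le_one)
lemma halfside_Suc: "halfside (Suc k) = halfside k / 2" by (simp add: halfside_def)
lemma mesh_pos [simp]: "0 < mesh k" by (simp add: mesh_def)
lemma mesh_neq_0 [simp]: "mesh k \<noteq> 0" using mesh_pos[of k] by linarith
lemma mesh_times_gridnum [simp]: "mesh k * real (gridnum k) = halfside k"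
  by (simp add: mesh_def less_imp_neq[OF gridnum_pos, symmetric])

lemma gridnum_mono: "j \<le> k \<Longrightarrow> gridnum j \<le> gridnum k"
  unfolding gridnum_def by (intro power_increasing fact_mono) auto

lemma halfside_antimono: "j \<le> k \<Longrightarrow> halfside k \<le> halfside j"
  unfolding halfside_def by (intro power_decreasing) auto

lemma mesh_antimono: "j \<le> k \<Longrightarrow> mesh k \<le> mesh j"
  unfolding mesh_def using gridnum_mono halfside_antimono
  by (intro frac_le) (auto intro: less_imp_le)

lemma two_power_le_gridnum: "2 ^ k \<le> gridnum k"
  unfolding gridnum_def by (intro power_increasing fact_ge_self) auto

lemma Suc_le_gridnum: "Suc k \<le> gridnum k"
  using less_exp[of k] two_power_le_gridnum[of k] by linarith

lemma halfside_tendsto_0: "halfside \<longlonglongrightarrow> 0"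
  unfolding halfside_def by (intro LIMSEQ_realpow_zero) auto

lemma mesh_le_halfside: "mesh k \<le> halfside k"
  using Suc_le_gridnum[of k] by (simp add: mesh_def field_simps)

lemma mesh_tendsto_0: "mesh \<longlonglongrightarrow> 0"
  by (rule tendsto_sandwich[OF _ _ tendsto_const halfside_tendsto_0])
     (auto simp: mesh_le_halfside less_imp_le)

lemma grid_subset_cube: "grid k \<subseteq> cube (halfside k)"
proof
  fix x :: "real ^ 'n" assume "x \<in> grid k"
  then obtain z where z: "x = grid_point k z" "\<And>i. z i \<in> grid_index k" by (auto simp: grid_def)
  have "\<bar>x $ i\<bar> \<le> halfside k" for i
  proof -
    have "\<bar>z i\<bar> \<le> int (gridnum k)" using z(2)[of i] by (auto simp: grid_index_def)
    then have "\<bar>real_of_int (z i)\<bar> \<le> real (gridnum k)" by linarith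
    then have "mesh k * \<bar>real_of_int (z i)\<bar> \<le> mesh k * real (gridnum k)"
      by (intro mult_left_mono less_imp_le[OF mesh_pos])
    then show ?thesis
      by (simp add: z(1) grid_point_def abs_mult abs_of_pos[OF mesh_pos])
  qed
  then show "x \<in> cube (halfside k)" by (simp add: cube_def)
qed

lemma finite_grid_index [simp]: "finite (grid_index k)" by (simp add: grid_index_def)

lemma card_grid_index: "card (grid_index k) \<le> 3 * gridnum k"
  using Suc_le_gridnum[of k] by (simp add: grid_index_def)

lemma finite_grid [simp]: "finite (grid k :: (real ^ 'n) set)"
  and card_grid: "card (grid k :: (real ^ 'n) set) \<le> (3 * gridnum k) ^ CARD('n)"
proof -
  let ?Z = "{z :: 'n \<Rightarrow> int. \<forall>i. z i \<in> grid_index k}"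
  have Z: "?Z = PiE UNIV (\<lambda>_. grid_index k)" by auto
  have fin: "finite ?Z" unfolding Z by (intro finite_PiE) auto
  then show "finite (grid k :: (real ^ 'n) set)" by (simp add: grid_def)
  have "card (grid k :: (real ^ 'n) set) \<le> card ?Z"
    unfolding grid_def by (rule card_image_le[OF fin])
  also have "\<dots> = card (grid_index k) ^ CARD('n)" unfolding Z by (subst card_PiE) auto
  also have "\<dots> \<le> (3 * gridnum k) ^ CARD('n)" using card_grid_index by (intro power_mono) auto
  finally show "card (grid k :: (real ^ 'n) set) \<le> (3 * gridnum k) ^ CARD('n)" .
qed

lemma finite_grid_surface: "finite (grid_surface k w :: (real ^ 'n) set)"
  by (rule finite_subset[OF _ finite_grid[of k]]) (auto simp: grid_surface_def grid_def)

text \<open>Near a face one coordinate has only \<open>2 * Suc w\<close> admissible values, so the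
  count grows like the power \<open>d - 1\<close> of \<open>gridnum k\<close>; this matches the area
  of a sphere of radius comparable to the mesh.\<close>

lemma card_grid_surface:
  "card (grid_surface k (int w) :: (real ^ 'n) set)
     \<le> CARD('n) * (2 * Suc w * (3 * gridnum k) ^ (CARD('n) - 1))"
proof -
  let ?m = "int (gridnum k)"
  define W where "W = {- ?m..- ?m + int w} \<union> {?m - int w..?m}"
  have cW: "card W \<le> 2 * Suc w"
    unfolding W_def by (rule order_trans[OF card_Un_le]) auto
  have fW: "finite W" by (simp add: W_def)
  define Z where "Z i = {z::'n \<Rightarrow> int. \<forall>j. z j \<in> (if j = i then W else grid_index k)}" for i
  have finZ: "finite (Z i)" for i unfolding Z_def by (rule card_fun_pointed(1)[OF fW]) simp
  have cZ: "card (Z i) \<le> 2 * Suc w * (3 * gridnum k) ^ (CARD('n) - 1)" for i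
    unfolding Z_def card_fun_pointed(2)[OF fW finite_grid_index]
    using cW card_grid_index by (intro mult_mono power_mono) auto
  have "grid_surface k (int w) \<subseteq> grid_point k ` (\<Union>i. Z i)"
    unfolding grid_surface_def
  proof (rule image_mono, clarify)
    fix z :: "'n \<Rightarrow> int" and i
    assume "\<forall>i. z i \<in> grid_index k" "?m - int w \<le> \<bar>z i\<bar>"
    moreover from this have "z i \<in> W" by (auto simp: W_def grid_index_def dest!: spec[of _ i])
    ultimately have "z \<in> Z i" by (auto simp: Z_def)
    then show "z \<in> (\<Union>i. Z i)" by blast
  qed
  then have "card (grid_surface k (int w) :: (real ^ 'n) set) \<le> card (grid_point k ` (\<Union>i. Z i))"
    using finZ by (intro card_mono) auto
  also have "\<dots> \<le> card (\<Union>i. Z i)" using finZ by (intro card_image_le) auto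
  also have "\<dots> \<le> (\<Sum>i\<in>UNIV. card (Z i))" by (intro card_UN_le) auto
  also have "\<dots> \<le> (\<Sum>i\<in>(UNIV::'n set). 2 * Suc w * (3 * gridnum k) ^ (CARD('n) - 1))"
    using cZ by (intro sum_mono) auto
  finally show ?thesis by simp
qed

text \<open>Rounding every coordinate down to a multiple of the mesh stays in the grid and costs at
  most one mesh step per coordinate.\<close>

lemma grid_dense:
  fixes y :: "real ^ 'n"
  assumes y: "y \<in> cube (halfside k)"
  shows "\<exists>p\<in>grid k. dist p y \<le> real CARD('n) * mesh k"
proof -
  define z where "z i = \<lfloor>y $ i / mesh k\<rfloor>" for i
  have z: "mesh k * of_int (z i) \<le> y $ i" "y $ i \<le> mesh k * of_int (z i) + mesh k" for i
  proof -
    have "of_int (z i) \<le> y $ i / mesh k" "y $ i / mesh k \<le> of_int (z i) + 1"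
      unfolding z_def by linarith+
    then show "mesh k * of_int (z i) \<le> y $ i" "y $ i \<le> mesh k * of_int (z i) + mesh k"
      by (simp_all add: field_simps)
  qed
  have "z i \<in> grid_index k" for i
  proof -
    have "\<bar>y $ i\<bar> \<le> mesh k * real (gridnum k)" using y by (simp add: cube_def)
    then have "- real (gridnum k) \<le> y $ i / mesh k" "y $ i / mesh k \<le> real (gridnum k)"
      unfolding abs_le_iff by (simp_all add: field_simps)
    then have "- int (gridnum k) \<le> z i" "z i \<le> int (gridnum k)"
      unfolding z_def by linarith+
    then show ?thesis by (simp add: grid_index_def)
  qed
  then have "grid_point k z \<in> grid k" by (auto simp: grid_def)
  moreover have "dist (grid_point k z) y \<le> real CARD('n) * mesh k"
    unfolding dist_norm
  proof (rule norm_le_card_mult)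
    fix i show "\<bar>(grid_point k z - y) $ i\<bar> \<le> mesh k"
      using z[of i] by (simp add: grid_point_def)
  qed
  ultimately show ?thesis by blast
qed

lemma zero_in_grid: "0 \<in> grid k"
proof -
  have "grid_point k (\<lambda>_. 0) = 0" by (simp add: grid_point_def vec_eq_iff)
  moreover have "grid_point k (\<lambda>_. 0) \<in> grid k" unfolding grid_def by (auto simp: grid_index_def)
  ultimately show ?thesis by metis
qed

lemma grid_subset_grids: "grid k \<subseteq> grids"
  by (auto simp: grids_def)

lemma grids_nonempty: "grids \<noteq> {}"
  using zero_in_grid grid_subset_grids by blast

lemma countable_grids: "countable grids"
  unfolding grids_def by (rule countable_UN) (simp_all add: countable_finite)

text \<open>The cubes shrink to the origin, so only finitely many of the finite grids leave a given
  ball around it.\<close>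

lemma compact_grids: "compact (grids :: (real ^ 'n) set)"
proof (rule compact_if_accumulates_only_at)
  show "0 \<in> (grids :: (real ^ 'n) set)" using zero_in_grid grid_subset_grids by blast
  fix e :: real assume e: "0 < e"
  have "(\<lambda>k. real CARD('n) * halfside k) \<longlonglongrightarrow> 0"
    by (intro tendsto_mult_right_zero halfside_tendsto_0)
  then have "\<forall>\<^sub>F k in sequentially. real CARD('n) * halfside k < e" using e by (rule order_tendstoD)
  then obtain K where K: "\<And>k. K \<le> k \<Longrightarrow> real CARD('n) * halfside k < e"
    by (auto simp: eventually_sequentially)
  have "grid k \<subseteq> (ball 0 e :: (real ^ 'n) set)" if "K \<le> k" for k
  proof
    fix x :: "real ^ 'n" assume "x \<in> grid k"
    then have "norm x \<le> real CARD('n) * halfside k"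
      using grid_subset_cube by (intro norm_le_card_mult) (auto simp: cube_def)
    then show "x \<in> ball 0 e" using K[OF that] by simp
  qed
  then have "grids - ball 0 e \<subseteq> (\<Union>k<K. grid k :: (real ^ 'n) set)"
    unfolding grids_def using not_le by blast
  then show "finite (grids - ball 0 e :: (real ^ 'n) set)"
    by (rule finite_subset) auto
qed

text \<open>Finer grids lie inside the \<open>k\<close>-th cube, where \<open>grid_dense\<close>
  applies; points of coarser grids are centres themselves.\<close>

lemma grids_cover:
  "grids \<subseteq> (\<Union>p\<in>(\<Union>j\<le>k. grid j). cball p (real CARD('n) * mesh k) :: (real ^ 'n) set)"
proof
  fix x :: "real ^ 'n" assume "x \<in> grids"
  then obtain j where j: "x \<in> grid j" by (auto simp: grids_def)
  have "\<exists>p\<in>(\<Union>j\<le>k. grid j). dist p x \<le> real CARD('n) * mesh k"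
  proof (cases "j \<le> k")
    case True
    then show ?thesis using j by (intro bexI[of _ x]) (auto intro: less_imp_le)
  next
    case False
    then have "x \<in> cube (halfside k)"
      using j grid_subset_cube[of j] halfside_antimono[of k j]
      by (auto simp: cube_def subset_iff intro: order_trans)
    then show ?thesis using grid_dense by blast
  qed
  then show "x \<in> (\<Union>p\<in>(\<Union>j\<le>k. grid j). cball p (real CARD('n) * mesh k))" by auto
qed

text \<open>The grids finer than the \<open>k\<close>-th lie in the inner half of the \<open>k\<close>-th cube, and the
  parallel set contains that cube; so only coarser grids and the outermost layers of the \<open>k\<close>-th grid
  have points at distance \<open>r\<close> from the boundary.\<close>
lemma parallel_boundary_grids_subset:
  fixes k :: nat
  defines "r \<equiv> 2 * real CARD('n) * mesh k"
  assumes k: "4 * CARD('n) \<le> gridnum k"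
  shows "parallel_boundary (grids :: (real ^ 'n) set) r
    \<subseteq> (\<Union>p\<in>(\<Union>j<k. grid j) \<union> grid_surface k (int (2 * CARD('n))). sphere p r)"
proof
  fix x :: "real ^ 'n" assume "x \<in> parallel_boundary grids r"
  then have xr: "infdist x grids = r" by (simp add: parallel_boundary_def)
  obtain p where p: "p \<in> grids" "infdist x grids = dist x p"
    using infdist_attains_inf[OF compact_imp_closed[OF compact_grids] grids_nonempty] by blast
  \<comment> \<open>Inside the cube the distance to the grids would be at most
    \<open>r / 2\<close>.\<close>
  have "x \<notin> cube (halfside k)"
  proof
    assume "x \<in> cube (halfside k)"
    then obtain q where q: "q \<in> grid k" "dist q x \<le> real CARD('n) * mesh k" using grid_dense by blast
    have "infdist x grids \<le> dist x q" using q(1) grid_subset_grids by (intro infdist_le) blast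
    then have "2 * (real CARD('n) * mesh k) \<le> real CARD('n) * mesh k"
      using q(2) xr unfolding r_def dist_commute[of x q] by linarith
    moreover have "0 < real CARD('n) * mesh k" by simp
    ultimately show False by linarith
  qed
  then obtain i where i: "halfside k < \<bar>x $ i\<bar>" by (auto simp: cube_def not_le)
  have xp: "\<bar>x $ i - p $ i\<bar> \<le> r"
    using component_le_norm_cart[of "x - p" i] p(2) xr by (simp add: dist_norm)
  obtain j where j: "p \<in> grid j" using p(1) by (auto simp: grids_def)
  have "p \<in> (\<Union>j<k. grid j) \<union> grid_surface k (int (2 * CARD('n)))"
  proof (cases j k rule: linorder_cases)
    case less
    then show ?thesis using j by blast
  next
    case greater
    \<comment> \<open>This case is contradictory. The assumption on \<open>gridnum k\<close> gives
      \<open>r \<le> halfside k / 2\<close>, and \<open>p\<close> lies in the half-size cube, so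
      \<open>x\<close> could not exceed \<open>halfside k\<close> in coordinate
      \<open>i\<close>.\<close>
    have "4 * real CARD('n) * mesh k \<le> real (gridnum k) * mesh k"
      using k by (intro mult_right_mono less_imp_le[OF mesh_pos]) linarith
    then have "r \<le> halfside k / 2" using mesh_times_gridnum[of k] by (simp add: r_def mult.commute)
    moreover have "\<bar>p $ i\<bar> \<le> halfside j" using j grid_subset_cube by (auto simp: cube_def)
    moreover have "halfside j \<le> halfside k / 2"
      using greater halfside_antimono[of "Suc k" j] by (simp add: halfside_Suc)
    ultimately show ?thesis using i xp by linarith
  next
    case equal
    obtain z where z: "p = grid_point k z" "\<And>i. z i \<in> grid_index k"
      using j equal by (auto simp: grid_def)
    \<comment> \<open>Since \<open>r\<close> is exactly \<open>2 * CARD('n)\<close> mesh steps,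
      \<open>p\<close> is at most that many steps inside a face.\<close>
    have "mesh k * (real (gridnum k) - 2 * real CARD('n)) \<le> mesh k * \<bar>real_of_int (z i)\<bar>"
    proof -
      have "\<bar>p $ i\<bar> = mesh k * \<bar>real_of_int (z i)\<bar>"
        by (simp add: z(1) grid_point_def abs_mult abs_of_pos[OF mesh_pos])
      moreover have "halfside k - r \<le> \<bar>p $ i\<bar>" using i xp by linarith
      ultimately show ?thesis by (simp add: r_def right_diff_distrib mult_ac)
    qed
    then have "real (gridnum k) - 2 * real CARD('n) \<le> \<bar>real_of_int (z i)\<bar>"
      using mesh_pos by (simp add: mult_le_cancel_left_pos)
    then have "int (gridnum k) - int (2 * CARD('n)) \<le> \<bar>z i\<bar>" by linarith
    then show ?thesis using z by (auto simp: grid_surface_def)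
  qed
  then show "x \<in> (\<Union>p\<in>(\<Union>j<k. grid j) \<union> grid_surface k (int (2 * CARD('n))). sphere p r)"
    using p(2) xr by (auto simp: dist_commute)
qed

lemma card_UN_grid:
  "card (\<Union>j\<le>k. grid j :: (real ^ 'n) set) \<le> Suc k * (3 * gridnum k) ^ CARD('n)"
proof -
  have "card (\<Union>j\<le>k. grid j :: (real ^ 'n) set) \<le> (\<Sum>j\<le>k. card (grid j :: (real ^ 'n) set))"
    by (intro card_UN_le) auto
  also have "\<dots> \<le> (\<Sum>j\<le>k. (3 * gridnum k) ^ CARD('n))"
    using gridnum_mono
    by (intro sum_mono order_trans[OF card_grid] power_mono mult_left_mono) auto
  finally show ?thesis by simp
qed

section \<open>The dimensions of the union of grids\<close>

lemma gridnum_power_le: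
  assumes "real N \<le> t * real (Suc k)"
  shows "real (gridnum k) ^ N \<le> real (gridnum (Suc k)) powr t"
proof -
  have "real (gridnum k) ^ N = 2 powr (real (fact k) * real N)"
    by (simp add: gridnum_def powr_powr powr_realpow[symmetric])
  also have "\<dots> \<le> 2 powr (real (fact k) * (t * real (Suc k)))"
    using assms by (intro powr_mono mult_left_mono) auto
  \<comment> \<open>The recursion of the factorial turns a factor \<open>Suc k\<close> in the
    exponent into a step from \<open>k\<close> to \<open>Suc k\<close>.\<close>
  also have "real (fact k) * (t * real (Suc k)) = real (fact (Suc k)) * t"
    by (simp add: algebra_simps)
  also have "2 powr \<dots> = real (gridnum (Suc k)) powr t"
    by (simp add: gridnum_def powr_powr[symmetric] powr_realpow[symmetric] del: fact_Suc)
  finally show ?thesis .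
qed

text \<open>For large \<open>k\<close> the power of \<open>gridnum k\<close> is at most
  \<open>gridnum (Suc k) powr t\<close>; multiplied by \<open>mesh (Suc k) powr t\<close> this is
  \<open>halfside (Suc k) powr t\<close>.\<close>

lemma gridnum_mesh_tendsto_0:
  assumes t: "0 < t"
  shows "(\<lambda>k. real (gridnum k) ^ N * mesh (Suc k) powr t) \<longlonglongrightarrow> 0"
proof (rule tendsto_sandwich[OF _ _ tendsto_const])
  have "(\<lambda>k. halfside (Suc k)) \<longlonglongrightarrow> 0" using halfside_tendsto_0 by (rule LIMSEQ_Suc)
  then show "(\<lambda>k. halfside (Suc k) powr t) \<longlonglongrightarrow> 0"
    by (rule tendsto_zero_powrI[OF _ tendsto_const]) (use t in \<open>auto simp: less_imp_le\<close>)
  show "\<forall>\<^sub>F k in sequentially. real (gridnum k) ^ N * mesh (Suc k) powr t \<le> halfside (Suc k) powr t"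
    unfolding eventually_sequentially
  proof (intro exI allI impI)
    fix k assume "nat \<lceil>real N / t\<rceil> \<le> k"
    then have "real N / t \<le> real (Suc k)" by linarith
    then have "real N \<le> t * real (Suc k)" using t by (simp add: field_simps)
    then have "real (gridnum k) ^ N * mesh (Suc k) powr t
        \<le> real (gridnum (Suc k)) powr t * mesh (Suc k) powr t"
      by (intro mult_right_mono gridnum_power_le) auto
    also have "\<dots> = halfside (Suc k) powr t"
      by (subst powr_mult[symmetric]) (simp_all add: less_imp_le mult.commute)
    finally show "real (gridnum k) ^ N * mesh (Suc k) powr t \<le> halfside (Suc k) powr t" .
  qed
qed auto

text \<open>Finds the scale for a given \<open>r\<close>: with \<open>D\<close> the dimension, the
  \<open>k\<close>-th grid is \<open>r\<close>-dense in a cube whose side is large compared with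
  \<open>r\<close>. The least admissible index \<open>n\<close> has
  \<open>r < D * mesh (n - 1)\<close>, and a positive power of that mesh is eventually below any
  fixed power of \<open>halfside n\<close>.\<close>

lemma eventually_between_meshes:
  assumes "0 < e" "0 < c" "0 < D"
  shows "\<forall>\<^sub>F r in at_right 0. \<exists>k. D * mesh k \<le> r \<and> r powr e \<le> c * halfside k ^ N"
proof -
  \<comment> \<open>The denominator absorbs \<open>D powr e\<close> and the factor 4 lost by halving
    the side twice.\<close>
  let ?c = "c / (D powr e * 4 ^ N)"
  have "0 < ?c" using assms by simp
  with gridnum_mesh_tendsto_0[OF assms(1)]
  have "\<forall>\<^sub>F k in sequentially. real (gridnum k) ^ N * mesh (Suc k) powr e < ?c"
    by (rule order_tendstoD)
  then obtain K where K: "\<And>k. K \<le> k \<Longrightarrow> real (gridnum k) ^ N * mesh (Suc k) powr e < ?c"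
    by (auto simp: eventually_sequentially)
  have small: "(D * mesh (Suc k)) powr e \<le> c * halfside (Suc (Suc k)) ^ N" if "K \<le> k" for k
  proof -
    \<comment> \<open>The side two steps later is a quarter of
      \<open>halfside k = 1 / 2 ^ k\<close>, which is at least \<open>1 / gridnum k\<close>.\<close>
    have "1 \<le> halfside (Suc (Suc k)) * (4 * real (gridnum k))"
    proof -
      have "2 ^ k \<le> real (gridnum k)"
        using two_power_le_gridnum[of k] by (metis of_nat_le_iff of_nat_numeral of_nat_power)
      then have "halfside k * 2 ^ k \<le> halfside k * real (gridnum k)"
        by (intro mult_left_mono less_imp_le[OF halfside_pos])
      moreover have "halfside k * 2 ^ k = 1"
        by (simp add: halfside_def power_mult_distrib[symmetric])
      ultimately show ?thesis by (simp add: halfside_Suc)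
    qed
    then have ge1: "1 \<le> halfside (Suc (Suc k)) ^ N * (4 ^ N * real (gridnum k) ^ N)"
      unfolding power_mult_distrib[symmetric] by (rule one_le_power)
    have "(D * mesh (Suc k)) powr e = D powr e * mesh (Suc k) powr e"
      by (rule powr_mult)
    also have "\<dots> \<le> D powr e * mesh (Suc k) powr e *
        (halfside (Suc (Suc k)) ^ N * (4 ^ N * real (gridnum k) ^ N))"
      by (rule mult_left_mono[OF ge1, of "D powr e * mesh (Suc k) powr e", unfolded mult_1_right]) simp
    also have "\<dots> = halfside (Suc (Suc k)) ^ N *
        (real (gridnum k) ^ N * mesh (Suc k) powr e * (D powr e * 4 ^ N))"
      by (simp add: mult_ac)
    also have "\<dots> \<le> halfside (Suc (Suc k)) ^ N * c"
    proof (intro mult_left_mono)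
      show "real (gridnum k) ^ N * mesh (Suc k) powr e * (D powr e * 4 ^ N) \<le> c"
        using K[OF that] assms by (simp add: pos_less_divide_eq)
    qed (simp add: less_imp_le)
    finally show ?thesis by (simp add: mult.commute)
  qed
  have "\<exists>k. D * mesh k \<le> r \<and> r powr e \<le> c * halfside k ^ N"
    if r: "0 < r" "r < D * mesh (Suc K)" for r
  proof -
    have "(\<lambda>k. D * mesh k) \<longlonglongrightarrow> 0" by (intro tendsto_mult_right_zero mesh_tendsto_0)
    then have "\<forall>\<^sub>F k in sequentially. D * mesh k < r" using r(1) by (rule order_tendstoD)
    then have ex: "\<exists>k. D * mesh k \<le> r"
      by (auto simp: eventually_sequentially intro: less_imp_le)
    define n where "n = (LEAST k. D * mesh k \<le> r)"
    have n: "D * mesh n \<le> r" unfolding n_def by (rule LeastI_ex[OF ex])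
    have "Suc K < n"
    proof (rule ccontr)
      assume "\<not> Suc K < n"
      then have "D * mesh (Suc K) \<le> D * mesh n"
        using assms by (intro mult_left_mono mesh_antimono) auto
      then show False using n r(2) by linarith
    qed
    \<comment> \<open>The shift by two allows minimality of \<open>n\<close> to be used at
      \<open>Suc k\<close> and \<open>small\<close> at \<open>k\<close>.\<close>
    define k where "k = n - 2"
    have k: "n = Suc (Suc k)" "K \<le> k" using \<open>Suc K < n\<close> by (simp_all add: k_def)
    have "\<not> D * mesh (Suc k) \<le> r"
      using not_less_Least[of "Suc k" "\<lambda>k. D * mesh k \<le> r"] k(1) unfolding n_def[symmetric] by simp
    then have "r powr e \<le> (D * mesh (Suc k)) powr e"
      using r assms by (intro powr_mono2) auto
    then show ?thesis using small[OF k(2)] n k(1) by (intro exI[of _ n]) auto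
  qed
  moreover have "0 < D * mesh (Suc K)" using assms by simp
  ultimately show ?thesis unfolding eventually_at_right_field by blast
qed

section \<open>Minkowski dimension of the grids\<close>

lemma Liminf_ge_1_neq_0:
  fixes f :: "'a \<Rightarrow> ennreal"
  assumes "\<forall>\<^sub>F x in F. 1 \<le> f x"
  shows "Liminf F f \<noteq> 0"
  using Liminf_bounded[OF assms] by auto

text \<open>At the scale \<open>k\<close> belonging to \<open>r\<close>, the volume bound is
  \<open>(halfside k / 2) ^ d * r powr (s - d)\<close>, and \<open>k\<close> is chosen to make this
  at least 1.\<close>

lemma Liminf_minkowski_content_grids_neq_0:
  assumes "s < real CARD('n)"
  shows "Liminf (at_right 0) (\<lambda>r. minkowski_content s r (grids :: (real ^ 'n) set)) \<noteq> 0"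
proof (rule Liminf_ge_1_neq_0)
  define d where "d = CARD('n)"
  have d: "0 < d" "s < real d" using assms by (simp_all add: d_def)
  have "\<forall>\<^sub>F r in at_right 0. \<exists>k. real d * mesh k \<le> r \<and> r powr (real d - s) \<le> (1/2) ^ d * halfside k ^ d"
    using d by (intro eventually_between_meshes) auto
  moreover have "\<forall>\<^sub>F r in at_right (0::real). 0 < r" by (rule eventually_at_right_less)
  ultimately show "\<forall>\<^sub>F r in at_right 0. 1 \<le> minkowski_content s r (grids :: (real ^ 'n) set)"
  proof eventually_elim
    case (elim r)
    then obtain k where k: "real d * mesh k \<le> r" "r powr (real d - s) \<le> (1/2) ^ d * halfside k ^ d"
      by blast
    have "1 = r powr (real d - s) * r powr (s - real d)"
      using elim by (simp add: powr_add[symmetric])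
    also have "\<dots> \<le> (1/2) ^ d * halfside k ^ d * r powr (s - real d)"
      using k(2) by (intro mult_right_mono) auto
    also have "\<dots> = (halfside k / 2) ^ d * r powr (s - real d)"
      by (simp add: power_mult_distrib[symmetric])
    finally have "1 \<le> ennreal ((halfside k / 2) ^ d * r powr (s - real d))"
      by (simp add: one_ennreal_def[symmetric] ennreal_leI flip: ennreal_1)
    also have "\<dots> \<le> minkowski_content s r (grids :: (real ^ 'n) set)"
      unfolding d_def
    proof (rule minkowski_content_ge)
      fix y :: "real ^ 'n" assume "y \<in> cube (halfside k)"
      then obtain p where "p \<in> grid k" "dist p y \<le> real d * mesh k"
        using grid_dense unfolding d_def by blast
      then show "\<exists>p\<in>grids. dist p y \<le> r"
        using k(1) grid_subset_grids by (meson order_trans subsetD)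
    qed (use elim in \<open>auto simp: less_imp_le\<close>)
    finally show ?case .
  qed
qed

text \<open>The exponent \<open>d\<close> itself already works, along the radii
  \<open>d * mesh k\<close>: the points of the grids up to the \<open>k\<close>-th are centres, and
  the resulting content is at most a constant times \<open>Suc k * halfside k\<close>.\<close>

lemma Liminf_minkowski_content_grids_eq_0:
  "Liminf (at_right 0) (\<lambda>r. minkowski_content (real CARD('n)) r (grids :: (real ^ 'n) set)) = 0"
proof (rule Liminf_at_right_eq_0I)
  define d where "d = CARD('n)"
  have d: "0 < d" by (simp add: d_def)
  show "(\<lambda>k. real d * mesh k) \<longlonglongrightarrow> 0" by (intro tendsto_mult_right_zero mesh_tendsto_0)
  show "0 < real d * mesh k" for k using d by simp
  have "(\<lambda>k. real (Suc k) * (1/2) ^ Suc k) \<longlonglongrightarrow> (0::real)"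
    using powser_times_n_limit_0[of "1/2::real"] by (intro LIMSEQ_Suc) simp
  then have "(\<lambda>k. (3 * real d) ^ d * 2 * (real (Suc k) * (1/2) ^ Suc k)) \<longlonglongrightarrow> 0"
    by (rule tendsto_mult_right_zero)
  then show "(\<lambda>k. (3 * real d) ^ d * (real (Suc k) * halfside k)) \<longlonglongrightarrow> 0"
    by (simp add: halfside_def mult.assoc)
  show "\<forall>\<^sub>F k in sequentially. minkowski_content (real CARD('n)) (real d * mesh k) (grids :: (real ^ 'n) set)
      \<le> ennreal ((3 * real d) ^ d * (real (Suc k) * halfside k))"
  proof (intro always_eventually allI)
    fix k
    let ?P = "\<Union>j\<le>k. grid j :: (real ^ 'n) set"
    have "minkowski_content (real d) (real d * mesh k) (grids :: (real ^ 'n) set)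
        \<le> ennreal (real (card ?P) * (real d * mesh k) powr real d)"
      using grid_subset_grids grids_cover[of k] unfolding d_def
      by (intro minkowski_content_le_card) auto
    also have "\<dots> \<le> ennreal ((3 * real d) ^ d * (real (Suc k) * halfside k))"
    proof (rule ennreal_leI)
      have "real (card ?P) * (real d * mesh k) powr real d = real (card ?P) * (real d * mesh k) ^ d"
        using d by (simp add: powr_realpow)
      also have "\<dots> \<le> real (Suc k * (3 * gridnum k) ^ d) * (real d * mesh k) ^ d"
        using card_UN_grid[of k, where 'n = 'n] unfolding d_def[symmetric]
        by (intro mult_right_mono zero_le_power) (simp_all only: of_nat_le_iff, simp add: less_imp_le)
      also have "\<dots> = (3 * real d) ^ d * (real (Suc k) * (mesh k * real (gridnum k)) ^ d)"
        by (simp only: of_nat_mult of_nat_power of_nat_numeral power_mult_distrib mult_ac)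
      \<comment> \<open>A single factor of \<open>halfside k \<le> 1\<close> is kept; it decays
        geometrically and beats \<open>Suc k\<close>.\<close>
      also have "\<dots> \<le> (3 * real d) ^ d * (real (Suc k) * halfside k)"
        using d power_decreasing[of 1 d "halfside k"]
        by (intro mult_left_mono) (auto simp: less_imp_le)
      finally show "real (card ?P) * (real d * mesh k) powr real d
        \<le> (3 * real d) ^ d * (real (Suc k) * halfside k)" .
    qed
    finally show "minkowski_content (real CARD('n)) (real d * mesh k) (grids :: (real ^ 'n) set)
      \<le> ennreal ((3 * real d) ^ d * (real (Suc k) * halfside k))" by (simp add: d_def)
  qed
qed

lemma lower_minkowski_dim_grids:
  "lower_minkowski_dim (grids :: (real ^ 'n) set) = ereal (real CARD('n))"
  unfolding lower_minkowski_dim_def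
proof (rule antisym)
  show "Inf {ereal s |s. 0 \<le> s \<and>
      Liminf (at_right 0) (\<lambda>r. minkowski_content s r (grids :: (real ^ 'n) set)) = 0}
    \<le> ereal (real CARD('n))"
    using Liminf_minkowski_content_grids_eq_0 by (intro Inf_lower) auto
  show "ereal (real CARD('n)) \<le> Inf {ereal s |s. 0 \<le> s \<and>
      Liminf (at_right 0) (\<lambda>r. minkowski_content s r (grids :: (real ^ 'n) set)) = 0}"
    using Liminf_minkowski_content_grids_neq_0 by (intro Inf_greatest) (force simp: not_less[symmetric])
qed

section \<open>Spherical dimension of the grids\<close>

lemma Liminf_hausdorff_measure_parallel_boundary_grids_neq_0:
  assumes "0 \<le> s" "s < real CARD('n) - 1"
  shows "Liminf (at_right 0) (\<lambda>r. hausdorff_measure (real CARD('n) - 1)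
     (parallel_boundary (grids :: (real ^ 'n) set) r) / ennreal (r powr (real CARD('n) - 1 - s))) \<noteq> 0"
proof (rule Liminf_ge_1_neq_0)
  define d where "d = CARD('n)"
  \<comment> \<open>The range \<open>0 \<le> s < d - 1\<close> excludes dimension one, as the
    projection bound requires.\<close>
  have d: "2 \<le> d" "0 < real d - 1 - s" using assms by (simp_all add: d_def)
  have "\<forall>\<^sub>F r in at_right 0. \<exists>k. real d * mesh k \<le> r \<and>
      r powr (real d - 1 - s) \<le> 1 * halfside k ^ (d - 1)"
    using d by (intro eventually_between_meshes) auto
  moreover have "\<forall>\<^sub>F r in at_right (0::real). 0 < r" by (rule eventually_at_right_less)
  ultimately show "\<forall>\<^sub>F r in at_right 0. 1 \<le> hausdorff_measure (real CARD('n) - 1)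
     (parallel_boundary (grids :: (real ^ 'n) set) r) / ennreal (r powr (real CARD('n) - 1 - s))"
  proof eventually_elim
    case (elim r)
    then obtain k where k: "real d * mesh k \<le> r" "r powr (real d - 1 - s) \<le> halfside k ^ (d - 1)"
      by auto
    let ?q = "r powr (real d - 1 - s)"
    have "ennreal (halfside k ^ (d - 1))
       \<le> hausdorff_measure (real d - 1) (parallel_boundary (grids :: (real ^ 'n) set) r)"
      unfolding d_def
    proof (rule hausdorff_measure_parallel_boundary_ge[OF compact_grids grids_nonempty])
      fix y :: "real ^ 'n" assume "y \<in> cube (halfside k)"
      then obtain p where "p \<in> grid k" "dist p y \<le> real d * mesh k"
        using grid_dense unfolding d_def by blast
      then have "p \<in> grids" "dist y p \<le> r"
        using k(1) grid_subset_grids by (auto simp: dist_commute)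
      then show "infdist y grids \<le> r" by (rule infdist_le2)
    qed (use d in \<open>simp_all add: d_def\<close>)
    then have "ennreal ?q \<le> hausdorff_measure (real d - 1) (parallel_boundary (grids :: (real ^ 'n) set) r)"
      using k(2) by (meson ennreal_leI order_trans)
    then have "ennreal ?q / ennreal ?q
      \<le> hausdorff_measure (real d - 1) (parallel_boundary (grids :: (real ^ 'n) set) r) / ennreal ?q"
      by (rule divide_right_mono_ennreal)
    moreover have "ennreal ?q / ennreal ?q = 1"
      using elim by (simp add: divide_ennreal)
    ultimately show ?case by (simp add: d_def)
  qed
qed

text \<open>The boundary lies on spheres of radius comparable to \<open>mesh (Suc k)\<close>. Those
  around the outer layers have bounded total area; those around the grids up to the
  \<open>k\<close>-th are controlled by their number, at most
  \<open>Suc k * (3 * gridnum k) ^ d\<close>.\<close>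

lemma hausdorff_measure_parallel_boundary_grids_le:
  "\<exists>C. \<forall>k. 4 * CARD('n) \<le> gridnum (Suc k) \<longrightarrow>
     hausdorff_measure (real CARD('n) - 1)
       (parallel_boundary (grids :: (real ^ 'n) set) (2 * real CARD('n) * mesh (Suc k)))
     \<le> ennreal (C * real (gridnum k) ^ (CARD('n) + 1))"
proof -
  define d where "d = CARD('n)"
  define e where "e = d - 1"
  \<comment> \<open>\<open>A\<close> is the constant in the count of the outer layers;
    \<open>B\<close> comes from the area bound of a sphere of radius
    \<open>2 * d * mesh (Suc k)\<close>.\<close>
  define A where "A = real d * (2 * real (Suc (2 * d)))"
  define B where "B = 2 * real d * (4 * real d ^ 2) ^ e"
  have d: "0 < d" by (simp add: d_def)
  have "hausdorff_measure (real d - 1)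
       (parallel_boundary (grids :: (real ^ 'n) set) (2 * real d * mesh (Suc k)))
     \<le> ennreal ((3 ^ d + A * 3 ^ e) * B * real (gridnum k) ^ (d + 1))"
    if k: "4 * d \<le> gridnum (Suc k)" for k
  proof -
    let ?P = "(\<Union>j<Suc k. grid j) \<union> grid_surface (Suc k) (int (2 * d)) :: (real ^ 'n) set"
    let ?h = "mesh (Suc k)" and ?M = "real (gridnum (Suc k))" and ?m = "real (gridnum k)"
    have h: "0 \<le> ?h" by (simp add: less_imp_le)
    have "card ?P \<le> Suc k * (3 * gridnum k) ^ d + d * (2 * Suc (2 * d) * (3 * gridnum (Suc k)) ^ e)"
      using card_UN_grid[of k, where 'n = 'n] card_grid_surface[of "Suc k" "2 * d", where 'n = 'n]
      unfolding d_def[symmetric] e_def lessThan_Suc_atMost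
      by (intro order_trans[OF card_Un_le] add_mono)
    then have "real (card ?P)
        \<le> real (Suc k * (3 * gridnum k) ^ d + d * (2 * Suc (2 * d) * (3 * gridnum (Suc k)) ^ e))"
      by (simp only: of_nat_le_iff)
    also have "\<dots> = real (Suc k) * (3 * ?m) ^ d + A * (3 * ?M) ^ e"
      by (simp add: A_def algebra_simps)
    finally have "real (card ?P) * ?h ^ e \<le> (real (Suc k) * (3 * ?m) ^ d + A * (3 * ?M) ^ e) * ?h ^ e"
      using h by (intro mult_right_mono) auto
    also have "\<dots> = real (Suc k) * (3 * ?m) ^ d * ?h ^ e + A * 3 ^ e * (?h * ?M) ^ e"
      unfolding power_mult_distrib by (simp only: algebra_simps)
    \<comment> \<open>In the layer term \<open>gridnum\<close> and mesh of the same level multiply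
      to a half-side, at most 1; in the coarse term the mesh is bounded by 1.\<close>
    also have "\<dots> \<le> ?m * (3 * ?m) ^ d * 1 + A * 3 ^ e * 1"
    proof (intro add_mono mult_mono)
      show "real (Suc k) \<le> ?m" using Suc_le_gridnum[of k] by (simp only: of_nat_le_iff)
      show "?h ^ e \<le> 1"
        using h mesh_le_halfside[of "Suc k"] halfside_le_1[of "Suc k"] by (intro power_le_one) linarith+
      show "(?h * ?M) ^ e \<le> 1"
        unfolding mesh_times_gridnum by (intro power_le_one) (auto simp: less_imp_le)
    qed (use h in \<open>auto simp: A_def less_imp_le\<close>)
    also have "\<dots> \<le> ?m * (3 * ?m) ^ d + A * 3 ^ e * ?m ^ (d + 1)"
      using Suc_le_gridnum[of k] by (intro add_mono mult_left_mono one_le_power) (auto simp: A_def)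
    also have "\<dots> = (3 ^ d + A * 3 ^ e) * ?m ^ (d + 1)"
      by (simp add: power_mult_distrib algebra_simps)
    finally have count: "real (card ?P) * ?h ^ e \<le> (3 ^ d + A * 3 ^ e) * ?m ^ (d + 1)" .
    have "hausdorff_measure (real d - 1)
       (parallel_boundary (grids :: (real ^ 'n) set) (2 * real d * ?h))
      \<le> ennreal (real (card ?P) * (2 * real d * (2 * real d * (2 * real d * ?h)) ^ e))"
      unfolding d_def e_def
    proof (rule hausdorff_measure_subset_spheres)
      show "parallel_boundary (grids :: (real ^ 'n) set) (2 * real CARD('n) * ?h)
        \<subseteq> (\<Union>p\<in>(\<Union>j<Suc k. grid j) \<union> grid_surface (Suc k) (int (2 * CARD('n))).
             sphere p (2 * real CARD('n) * ?h))"
        using k unfolding d_def by (rule parallel_boundary_grids_subset)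
    qed (auto simp: finite_grid_surface)
    also have "real (card ?P) * (2 * real d * (2 * real d * (2 * real d * ?h)) ^ e)
        = real (card ?P) * ?h ^ e * B"
      by (simp add: B_def power_mult_distrib power2_eq_square mult_ac)
    also have "ennreal \<dots> \<le> ennreal ((3 ^ d + A * 3 ^ e) * ?m ^ (d + 1) * B)"
      using count by (intro ennreal_leI mult_right_mono) (auto simp: B_def)
    finally show ?thesis by (simp only: mult_ac)
  qed
  then show ?thesis unfolding d_def by blast
qed

text \<open>Along \<open>2 * d * mesh (Suc k)\<close> the quotient is at most a constant times
  \<open>gridnum k ^ (d + 1) * mesh (Suc k) powr t\<close> with \<open>t = s - (d - 1) > 0\<close>,
  which tends to 0.\<close>

lemma Liminf_hausdorff_measure_parallel_boundary_grids_eq_0: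
  assumes s: "real CARD('n) - 1 < s"
  shows "Liminf (at_right 0) (\<lambda>r. hausdorff_measure (real CARD('n) - 1)
     (parallel_boundary (grids :: (real ^ 'n) set) r) / ennreal (r powr (real CARD('n) - 1 - s))) = 0"
proof -
  define d where "d = CARD('n)"
  define t where "t = s - (real d - 1)"
  have d: "0 < d" and t: "0 < t" using s by (simp_all add: d_def t_def)
  obtain C where C: "\<And>k. 4 * d \<le> gridnum (Suc k) \<Longrightarrow> hausdorff_measure (real d - 1)
       (parallel_boundary (grids :: (real ^ 'n) set) (2 * real d * mesh (Suc k)))
     \<le> ennreal (C * real (gridnum k) ^ (d + 1))"
    using hausdorff_measure_parallel_boundary_grids_le[where 'n = 'n] unfolding d_def by blast
  let ?\<rho> = "\<lambda>k. 2 * real d * mesh (Suc k)"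
  let ?c = "\<lambda>k. C * (2 * real d) powr t * (real (gridnum k) ^ (d + 1) * mesh (Suc k) powr t)"
  have "Liminf (at_right 0) (\<lambda>r. hausdorff_measure (real d - 1)
     (parallel_boundary (grids :: (real ^ 'n) set) r) / ennreal (r powr - t)) = 0"
  proof (rule Liminf_at_right_eq_0I)
    show "?\<rho> \<longlonglongrightarrow> 0" by (intro tendsto_mult_right_zero LIMSEQ_Suc mesh_tendsto_0)
    show "0 < ?\<rho> k" for k using d by simp
    show "?c \<longlonglongrightarrow> 0" by (intro tendsto_mult_right_zero gridnum_mesh_tendsto_0 t)
    show "\<forall>\<^sub>F k in sequentially. hausdorff_measure (real d - 1)
       (parallel_boundary (grids :: (real ^ 'n) set) (?\<rho> k)) / ennreal (?\<rho> k powr - t) \<le> ennreal (?c k)"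
      unfolding eventually_sequentially
    proof (intro exI allI impI)
      fix k assume "4 * d \<le> k"
      then have "4 * d \<le> gridnum (Suc k)" using Suc_le_gridnum[of "Suc k"] by linarith
      then have "hausdorff_measure (real d - 1) (parallel_boundary (grids :: (real ^ 'n) set) (?\<rho> k))
           / ennreal (?\<rho> k powr - t)
         \<le> ennreal (C * real (gridnum k) ^ (d + 1)) / ennreal (?\<rho> k powr - t)"
        by (intro divide_right_mono_ennreal C)
      also have "\<dots> \<le> ennreal (?c k)"
      \<comment> \<open>\<open>C\<close> was obtained without a sign; if it is negative,
        \<open>ennreal\<close> truncates the numerator to 0.\<close>
      proof (cases "0 \<le> C")
        case True
        then have "ennreal (C * real (gridnum k) ^ (d + 1)) / ennreal (?\<rho> k powr - t)
            = ennreal (C * real (gridnum k) ^ (d + 1) / ?\<rho> k powr - t)"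
          using d by (intro divide_ennreal) auto
        also have "C * real (gridnum k) ^ (d + 1) / ?\<rho> k powr - t = ?c k"
          using d by (simp add: powr_minus powr_mult divide_inverse mult_ac)
        finally show ?thesis by simp
      next
        case False
        then have "ennreal (C * real (gridnum k) ^ (d + 1)) = 0"
          by (intro ennreal_neg mult_nonpos_nonneg) auto
        then show ?thesis by simp
      qed
      finally show "hausdorff_measure (real d - 1)
       (parallel_boundary (grids :: (real ^ 'n) set) (?\<rho> k)) / ennreal (?\<rho> k powr - t) \<le> ennreal (?c k)" .
    qed
  qed
  then show ?thesis by (simp add: t_def d_def)
qed

lemma lower_spherical_dim_grids:
  "lower_spherical_dim (grids :: (real ^ 'n) set) = ereal (real CARD('n) - 1)"
proof -
  define S where "S = {s. 0 \<le> s \<and> Liminf (at_right 0) (\<lambda>r. hausdorff_measure (real CARD('n) - 1)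
     (parallel_boundary (grids :: (real ^ 'n) set) r) / ennreal (r powr (real CARD('n) - 1 - s))) = 0}"
  have "lower_spherical_dim (grids :: (real ^ 'n) set) = Inf (ereal ` S)"
    unfolding lower_spherical_dim_def S_def by (simp add: setcompr_eq_image)
  also have "\<dots> = ereal (real CARD('n) - 1)"
  proof (rule antisym)
    show "Inf (ereal ` S) \<le> ereal (real CARD('n) - 1)"
    \<comment> \<open>Vanishing has been shown only for exponents strictly above
      \<open>d - 1\<close>, so the infimum is approached from above.\<close>
    proof (rule ereal_le_epsilon2)
      fix e :: real assume "0 < e"
      then have "real CARD('n) - 1 + e \<in> S"
        using Liminf_hausdorff_measure_parallel_boundary_grids_eq_0[of "real CARD('n) - 1 + e", where 'n = 'n]
        by (simp add: S_def)
      then show "Inf (ereal ` S) \<le> ereal (real CARD('n) - 1) + ereal e"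
        by (intro Inf_lower) force
    qed
    show "ereal (real CARD('n) - 1) \<le> Inf (ereal ` S)"
      using Liminf_hausdorff_measure_parallel_boundary_grids_neq_0[where 'n = 'n]
      by (intro Inf_greatest) (force simp: S_def not_less[symmetric])
  qed
  finally show ?thesis .
qed

theorem proposition5p3:
  shows "\<exists>E :: (real ^ 'n) set.
           compact E \<and>
           hausdorff_measure (real CARD('n)) E = 0 \<and>
           lower_minkowski_dim E = ereal (real CARD('n)) \<and>
           lower_spherical_dim E = ereal (real CARD('n) - 1)"
  using compact_grids hausdorff_measure_countable[OF countable_grids, of "real CARD('n)"]
    lower_minkowski_dim_grids[where 'n = 'n] lower_spherical_dim_grids[where 'n = 'n]
  by (intro exI[of _ grids]) auto

end
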